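(* Let $\mathbf{F}$ be a field of characteristic $2$. Then any two elements of $\mathfrak{sl}_4(\mathbf{F})$ generate a Lie algebra of dimension at most $9$ over $\mathbf{F}$. In particular, $\mathfrak{sl}_4(\mathbf{F})$ is not $2$-generated. It is, however, $3$-generated.
   Context: $\mathfrak{sl}_4(\mathbf{F})$ is the Lie algebra over $\mathbf{F}$ of traceless $4\times 4$ matrices with bracket $[x,y]=xy-yx$. The Lie algebra generated by some elements is the smallest Lie subalgebra over $\mathbf{F}$ (an $\mathbf{F}$-subspace closed under the bracket) containing them. A Lie algebra over $\mathbf{F}$ is $k$-generated if it is generated by some $k$ of its elements. The field $\mathbf{F}$ may be finite or infinite. *)

theory Defs
  imports "HOL-Analysis.Analysis"
begin

text \<open>
  The library's \<open>*s\<close> on \<open>'a^'n^'n\<close> scales by vectors (the entries of the outer vector)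
  and \<open>*\<^sub>R\<close> only by reals, so the structure of an \<open>'a\<close>-vector space on matrices
  is set up here.
\<close>

definition mat_scale :: "'a::field \<Rightarrow> 'a^'n^'m \<Rightarrow> 'a^'n^'m"
  where "mat_scale c A = (\<chi> i j. c * A $ i $ j)"

definition mat_unit :: "'m::finite \<times> 'n::finite \<Rightarrow> 'a::field^'n^'m"
  where "mat_unit p = (\<chi> i j. if (i, j) = p then 1 else 0)"

interpretation mat_vs: vector_space "mat_scale :: 'a::field \<Rightarrow> 'a^'n^'m \<Rightarrow> 'a^'n^'m"
  by unfold_locales (simp_all add: mat_scale_def vec_eq_iff algebra_simps)

lemma mat_unit_expansion:
  "(\<Sum>p\<in>UNIV. mat_scale (f p) (mat_unit p)) = (\<chi> i j. f (i, j))"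
proof -
  have "(\<Sum>p\<in>UNIV. f p * (if (i, j) = p then 1 else 0)) = f (i, j)" for i j
    using sum.delta'[of UNIV "(i, j)" f] by (simp add: if_distrib[of "(*) _"] cong: if_cong)
  then show ?thesis
    by (simp add: vec_eq_iff mat_scale_def mat_unit_def)
qed

lemma inj_mat_unit: "inj (mat_unit :: 'm::finite \<times> 'n::finite \<Rightarrow> 'a::field^'n^'m)"
proof (rule injI)
  fix p q :: "'m \<times> 'n"
  assume "(mat_unit p :: 'a^'n^'m) = mat_unit q"
  then have "(mat_unit p :: 'a^'n^'m) $ fst p $ snd p = mat_unit q $ fst p $ snd p"
    by simp
  then show "p = q"
    by (simp add: mat_unit_def split: if_splits)
qed

interpretation mat_vs: finite_dimensional_vector_space
  "mat_scale :: 'a::field \<Rightarrow> 'a^'n^'m \<Rightarrow> 'a^'n^'m" "range mat_unit"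
proof unfold_locales
  show "finite (range mat_unit :: ('a^'n^'m) set)"
    by simp
  show "mat_vs.independent (range mat_unit :: ('a^'n^'m) set)"
  proof (rule mat_vs.independent_if_scalars_zero)
    fix f :: "'a^'n^'m \<Rightarrow> 'a" and x :: "'a^'n^'m"
    assume eq: "(\<Sum>x\<in>range mat_unit. mat_scale (f x) x) = 0" and "x \<in> range mat_unit"
    then obtain p where p: "x = mat_unit p"
      by auto
    have "(\<chi> i j. f (mat_unit (i, j))) = (0 :: 'a^'n^'m)"
      using eq by (simp add: sum.reindex[OF inj_mat_unit]
          mat_unit_expansion[where f = "\<lambda>p. f (mat_unit p)"])
    then show "f x = 0"
      unfolding p by (cases p) (simp add: vec_eq_iff)
  qed simp
  show "mat_vs.span (range mat_unit) = (UNIV :: ('a^'n^'m) set)"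
  proof (intro equalityI subsetI UNIV_I)
    fix A :: "'a^'n^'m"
    have "A = (\<Sum>p\<in>UNIV. mat_scale (A $ fst p $ snd p) (mat_unit p))"
      by (simp add: mat_unit_expansion)
    also have "\<dots> \<in> mat_vs.span (range mat_unit)"
      by (intro mat_vs.span_sum mat_vs.span_scale mat_vs.span_base) simp
    finally show "A \<in> mat_vs.span (range mat_unit)" .
  qed
qed

definition lie_bracket :: "'a::field^'n^'n \<Rightarrow> 'a^'n^'n \<Rightarrow> 'a^'n^'n"
  where "lie_bracket x y = x ** y - y ** x"

definition sl :: "('a::field^'n^'n) set"
  where "sl = {A. trace A = 0}"

definition lie_subalgebra :: "('a::field^'n^'n) set \<Rightarrow> bool"
  where "lie_subalgebra L \<longleftrightarrow>
    mat_vs.subspace L \<and> (\<forall>x\<in>L. \<forall>y\<in>L. lie_bracket x y \<in> L)"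

text \<open>
  The hull is taken among all Lie subalgebras of the full matrix algebra; for a subset of a
  Lie subalgebra it coincides with the one taken inside that subalgebra
  (\<open>lie_generated_least\<close>).
\<close>

definition lie_generated :: "('a::field^'n^'n) set \<Rightarrow> ('a^'n^'n) set"
  where "lie_generated S = lie_subalgebra hull S"

lemma lie_subalgebra_sl: "lie_subalgebra (sl :: ('a::field^'n^'n) set)"
proof -
  have "trace (mat_scale c A) = c * trace A" for c and A :: "'a^'n^'n"
    by (simp add: trace_def mat_scale_def sum_distrib_left)
  moreover have "trace (lie_bracket x y) = 0" for x y :: "'a^'n^'n"
    unfolding lie_bracket_def trace_sub by (subst trace_mul_sym) (rule diff_self)
  moreover have "trace (0 :: 'a^'n^'n) = 0"
    by (simp add: trace_def)
  ultimately show ?thesis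
    by (simp add: lie_subalgebra_def mat_vs.subspace_def sl_def trace_add)
qed

lemma lie_subalgebra_lie_generated: "lie_subalgebra (lie_generated S)"
  unfolding lie_generated_def
proof (rule hull_in)
  fix T :: "('a^'n^'n) set set"
  assume "\<forall>L\<in>T. lie_subalgebra L"
  then show "lie_subalgebra (\<Inter>T)"
    unfolding lie_subalgebra_def by (auto intro!: mat_vs.subspace_Inter)
qed

lemma lie_generated_superset: "S \<subseteq> lie_generated S"
  unfolding lie_generated_def by (rule hull_subset)

lemma lie_generated_least: "lie_generated S \<subseteq> L" if "S \<subseteq> L" "lie_subalgebra L"
  unfolding lie_generated_def using that by (rule hull_minimal)

text \<open>The generators form a list and need not be distinct.\<close>

definition lie_k_generated :: "nat \<Rightarrow> ('a::field^'n^'n) set \<Rightarrow> bool"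
  where "lie_k_generated k L \<longleftrightarrow>
    (\<exists>xs. length xs = k \<and> set xs \<subseteq> L \<and> lie_generated (set xs) = L)"

end

theory Submission
  imports Defs
begin

text \<open>
  Over a field of characteristic two, \<open>[x\<^sup>2, v] = [x, [x, v]]\<close> for all matrices, because the
  middle term \<open>2 x v x\<close> vanishes. For the same reason \<open>[x, [x, [x, y]]]\<close> is the sum of the four
  words \<open>x\<^sup>3 y\<close>, \<open>x\<^sup>2 y x\<close>, \<open>x y x\<^sup>2\<close>, \<open>y x\<^sup>3\<close>, which is the derivative of the fourth power at
  \<open>x\<close> in the direction \<open>y\<close>. For \<open>4 \<times> 4\<close> matrices the fourth power is governed by the
  Cayley--Hamilton theorem, whose derivative (\<open>cayley_hamilton_linearised\<close>) puts
  \<open>[x, [x, [x, y]]]\<close> into the span of \<open>1\<close>, \<open>x\<close>, \<open>x\<^sup>2\<close>, \<open>y\<close> and \<open>[x, y]\<close> once \<open>x\<close> and \<open>y\<close> have trace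
  zero (\<open>lie_bracket_cube_in_span\<close>).

  Let \<open>V\<close> be the span of the nine matrices \<open>1\<close>, \<open>x\<close>, \<open>y\<close>, \<open>x\<^sup>2\<close>, \<open>y\<^sup>2\<close>, \<open>[x, y]\<close>, \<open>[x\<^sup>2, y]\<close>, \<open>[x, y\<^sup>2]\<close>,
  \<open>[x\<^sup>2, y\<^sup>2]\<close>. The bracket with \<open>x\<close> maps \<open>V\<close> to itself: it takes \<open>[x, y]\<close> to \<open>[x\<^sup>2, y]\<close> and
  \<open>[x, y\<^sup>2]\<close> to \<open>[x\<^sup>2, y\<^sup>2]\<close>, and on \<open>[x\<^sup>2, y]\<close> and \<open>[x\<^sup>2, y\<^sup>2]\<close> it is a threefold bracket with \<open>x\<close>. The
  square \<open>x\<^sup>2\<close> acts as \<open>x\<close> does twice, and \<open>V\<close> is symmetric in \<open>x\<close> and \<open>y\<close>; so \<open>x\<close>, \<open>x\<^sup>2\<close>, \<open>y\<close>, \<open>y\<^sup>2\<close>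
  normalise \<open>V\<close>. By the Jacobi identity the normaliser is a Lie algebra, so it contains the nine
  spanning matrices, and \<open>V\<close> is itself a Lie algebra
  (\<open>lie_subalgebra_span_two_generator_spanning_set\<close>). It contains \<open>x\<close> and \<open>y\<close>, which bounds the
  dimension of what they generate by nine.

  The off-diagonal matrix units already make the dimension of the traceless matrices at least
  twelve, so two elements are not enough. The three elements \<open>E\<^sub>1\<^sub>2\<close>, \<open>E\<^sub>2\<^sub>3\<close>, \<open>E\<^sub>3\<^sub>4 + E\<^sub>4\<^sub>1\<close> are enough:
  their brackets separate the two summands of the third, which leaves the units along a directed
  4-cycle, and these produce all off-diagonal units (\<open>sl_4_lie_3_generated\<close>).
\<close>

section \<open>Matrices as a Lie algebra\<close>

lemma matrix_add_rdistrib: "(B + C) ** (A :: 'a::field^'n^'n) = B ** A + C ** A"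
  by (simp add: matrix_matrix_mult_def vec_eq_iff distrib_right sum.distrib)

lemma lie_bracket_add_left: "lie_bracket (u + v) w = lie_bracket u w + lie_bracket v w"
  by (simp add: lie_bracket_def matrix_add_ldistrib matrix_add_rdistrib)

lemma lie_bracket_scale_left: "lie_bracket (mat_scale c u) w = mat_scale c (lie_bracket u w)"
  by (simp add: lie_bracket_def mat_scale_def matrix_matrix_mult_def vec_eq_iff
      sum_distrib_left algebra_simps)

lemma lie_bracket_add_right: "lie_bracket w (u + v) = lie_bracket w u + lie_bracket w v"
  by (simp add: lie_bracket_def matrix_add_ldistrib matrix_add_rdistrib)

lemma lie_bracket_scale_right: "lie_bracket w (mat_scale c u) = mat_scale c (lie_bracket w u)"
  by (simp add: lie_bracket_def mat_scale_def matrix_matrix_mult_def vec_eq_iff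
      sum_distrib_left algebra_simps)

lemma lie_bracket_zero_left [simp]: "lie_bracket 0 w = 0"
  by (simp add: lie_bracket_def)

lemma lie_bracket_zero_right [simp]: "lie_bracket w 0 = 0"
  by (simp add: lie_bracket_def)

lemma lie_bracket_self [simp]: "lie_bracket u u = 0"
  by (simp add: lie_bracket_def)

lemma lie_bracket_mat_1_left [simp]: "lie_bracket (mat 1) u = 0"
  by (simp add: lie_bracket_def)

lemma lie_bracket_mat_1_right [simp]: "lie_bracket u (mat 1) = 0"
  by (simp add: lie_bracket_def)

lemma lie_bracket_square_self [simp]: "lie_bracket x (x ** x) = 0"
  by (simp add: lie_bracket_def matrix_mul_assoc)

lemma matrix_diff_ldistrib: "(A :: 'a::field^'n^'n) ** (B - C) = A ** B - A ** C"
  by (simp add: matrix_matrix_mult_def vec_eq_iff right_diff_distrib sum_subtractf)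

lemma matrix_diff_rdistrib: "((B :: 'a::field^'n^'n) - C) ** A = B ** A - C ** A"
  by (simp add: matrix_matrix_mult_def vec_eq_iff left_diff_distrib sum_subtractf)

lemma lie_bracket_jacobi:
  "lie_bracket (lie_bracket u v) w
    = lie_bracket u (lie_bracket v w) - lie_bracket v (lie_bracket u w)"
  by (simp add: lie_bracket_def matrix_diff_ldistrib matrix_diff_rdistrib matrix_mul_assoc)

lemma lie_bracket_in_span:
  assumes "\<And>b. b \<in> B \<Longrightarrow> lie_bracket u b \<in> mat_vs.span C" "v \<in> mat_vs.span B"
  shows "lie_bracket u v \<in> mat_vs.span C"
  using assms(2)
proof (induction rule: mat_vs.span_induct_alt)
  case base
  show ?case by (simp add: mat_vs.span_zero)
next
  case (step c b v)
  then show ?case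
    by (simp add: lie_bracket_add_right lie_bracket_scale_right mat_vs.span_add
        mat_vs.span_scale assms(1))
qed

text \<open>
  The set \<open>V\<close> need not be closed under the bracket: the normaliser serves to reduce closure of \<open>V\<close>
  to the action of a few elements on it.
\<close>

definition lie_normalizer :: "('a::field^'n^'n) set \<Rightarrow> ('a^'n^'n) set"
  where "lie_normalizer V = {u. \<forall>v\<in>V. lie_bracket u v \<in> V}"

text \<open>
  By the Jacobi identity \<open>[u, v]\<close> acts as the commutator of the actions of \<open>u\<close> and \<open>v\<close>, and both of
  these preserve \<open>V\<close>.
\<close>

lemma lie_subalgebra_lie_normalizer:
  assumes "mat_vs.subspace V"
  shows "lie_subalgebra (lie_normalizer V)"
  using assms
  by (auto simp: lie_subalgebra_def lie_normalizer_def mat_vs.subspace_def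
      lie_bracket_add_left lie_bracket_scale_left lie_bracket_jacobi
      intro!: mat_vs.subspace_diff)

lemma lie_subalgebra_if_subset_lie_normalizer:
  "mat_vs.subspace V \<Longrightarrow> V \<subseteq> lie_normalizer V \<Longrightarrow> lie_subalgebra V"
  by (auto simp: lie_subalgebra_def lie_normalizer_def)

section \<open>The linearised Cayley--Hamilton identity\<close>

definition minor2 :: "'a::field^4^4 \<Rightarrow> 4 \<Rightarrow> 4 \<Rightarrow> 'a"
  where "minor2 x i j = x$i$i * x$j$j - x$i$j * x$j$i"

definition minor3 :: "'a::field^4^4 \<Rightarrow> 4 \<Rightarrow> 4 \<Rightarrow> 4 \<Rightarrow> 'a"
  where "minor3 x i j k =
    x$i$i * (x$j$j * x$k$k - x$j$k * x$k$j)
    - x$i$j * (x$j$i * x$k$k - x$j$k * x$k$i)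
    + x$i$k * (x$j$i * x$k$j - x$j$j * x$k$i)"

text \<open>
  The next two constants are the elementary symmetric functions \<open>e\<^sub>2\<close> and \<open>e\<^sub>3\<close> of the eigenvalues, so
  up to sign coefficients of the characteristic polynomial. They are taken as sums of principal
  minors since expressing them by traces of powers requires division by \<open>2\<close> and \<open>3\<close>.
\<close>

definition char_coeff2 :: "'a::field^4^4 \<Rightarrow> 'a"
  where "char_coeff2 x =
    minor2 x 1 2 + minor2 x 1 3 + minor2 x 1 4 + minor2 x 2 3 + minor2 x 2 4 + minor2 x 3 4"

definition char_coeff3 :: "'a::field^4^4 \<Rightarrow> 'a"
  where "char_coeff3 x = minor3 x 1 2 3 + minor3 x 1 2 4 + minor3 x 1 3 4 + minor3 x 2 3 4"

text \<open>
  This is the derivative at \<open>x\<close> in the direction \<open>y\<close> of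
  \<open>x\<^sup>4 - e\<^sub>1 x\<^sup>3 + e\<^sub>2 x\<^sup>2 - e\<^sub>3 x + e\<^sub>4 = 0\<close>. The derivative of \<open>e\<^sub>k\<close> is the trace of
  \<open>(x\<^bsup>k-1\<^esup> - e\<^sub>1 x\<^bsup>k-2\<^esup> + \<dots>) y\<close>, which is where the trace coefficients come from. Each matrix
  entry is a polynomial identity with integer coefficients in the entries of \<open>x\<close> and \<open>y\<close>; checking
  it directly avoids specialising \<open>x + t y\<close> to field elements \<open>t\<close>, of which a small field has too few.
\<close>

lemma cayley_hamilton_linearised:
  fixes x y :: "'a::field^4^4"
  defines "e2 \<equiv> char_coeff2 x" and "e3 \<equiv> char_coeff3 x"
  shows "x**x**x**y + x**x**y**x + x**y**x**x + y**x**x**x =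
      mat_scale (trace x) (x**x**y + x**y**x + y**x**x)
    + mat_scale (trace y) (x**x**x)
    - mat_scale (trace x * trace y - trace (x**y)) (x**x)
    - mat_scale e2 (x**y + y**x)
    + mat_scale (trace (x**x**y) - trace x * trace (x**y) + e2 * trace y) x
    + mat_scale e3 y
    + mat_scale (trace (x**x**x**y) - trace x * trace (x**x**y)
        + e2 * trace (x**y) - e3 * trace y) (mat 1)"
proof -
  have "(1::4) \<noteq> 2" "(1::4) \<noteq> 3" "(1::4) \<noteq> 4" "(2::4) \<noteq> 3" "(2::4) \<noteq> 4" "(3::4) \<noteq> 4"
    by simp_all
  note distinct = this this[symmetric]
  show ?thesis
    unfolding vec_eq_iff forall_4 e2_def e3_def
    by (simp only: mat_scale_def mat_def matrix_matrix_mult_def vec_lambda_beta sum_4 trace_def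
        char_coeff2_def char_coeff3_def minor2_def minor3_def
        vector_add_component vector_minus_component distinct refl if_True if_False)
      (intro conjI; algebra)
qed

section \<open>Characteristic two\<close>

lemma matrix_minus_CHAR_2:
  fixes A B :: "'a::field^'n^'n"
  assumes "CHAR('a) = 2"
  shows "A - B = A + B"
  by (simp add: vec_eq_iff minus_CHAR_2[OF assms])

lemma matrix_add_self_CHAR_2:
  fixes A :: "'a::field^'n^'n"
  assumes "CHAR('a) = 2"
  shows "A + A = 0"
  using matrix_minus_CHAR_2[OF assms, of A A] by simp

lemma lie_bracket_commute_CHAR_2:
  fixes x y :: "'a::field^'n^'n"
  assumes "CHAR('a) = 2"
  shows "lie_bracket x y = lie_bracket y x"
  by (simp add: lie_bracket_def matrix_minus_CHAR_2[OF assms] add.commute)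

lemma lie_bracket_square_CHAR_2:
  fixes x y :: "'a::field^'n^'n"
  assumes "CHAR('a) = 2"
  shows "lie_bracket (x ** x) y = lie_bracket x (lie_bracket x y)"
proof -
  have "lie_bracket x (lie_bracket x y) = x**x**y + (x**y**x + x**y**x) + y**x**x"
    by (simp add: lie_bracket_def matrix_minus_CHAR_2[OF assms] matrix_add_ldistrib
        matrix_add_rdistrib matrix_mul_assoc add.assoc)
  then show ?thesis
    by (simp add: lie_bracket_def matrix_minus_CHAR_2[OF assms] matrix_add_self_CHAR_2[OF assms]
        matrix_mul_assoc)
qed

text \<open>
  Expanding gives the binomial coefficients \<open>1, 3, 3, 1\<close>, all of them odd, so that the threefold
  bracket coincides with the derivative of the fourth power.
\<close>

lemma lie_bracket_cube_CHAR_2: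
  fixes x y :: "'a::field^'n^'n"
  assumes "CHAR('a) = 2"
  shows "lie_bracket x (lie_bracket x (lie_bracket x y)) =
    x**x**x**y + x**x**y**x + x**y**x**x + y**x**x**x"
proof -
  have "lie_bracket x (lie_bracket x (lie_bracket x y)) = lie_bracket (x ** x) (lie_bracket x y)"
    by (simp add: lie_bracket_square_CHAR_2[OF assms])
  also have "\<dots> = x**x**x**y + x**x**y**x + x**y**x**x + y**x**x**x"
    by (simp add: lie_bracket_def matrix_minus_CHAR_2[OF assms] matrix_add_ldistrib
        matrix_add_rdistrib matrix_mul_assoc ac_simps)
  finally show ?thesis .
qed

text \<open>
  The trace of \<open>x\<^sup>2\<close> is \<open>e\<^sub>1\<^sup>2 - 2 e\<^sub>2\<close>. This allows \<open>y\<^sup>2\<close> in the place of \<open>y\<close> in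
  the threefold bracket \<open>[x, [x, [x, y]]]\<close>.
\<close>

lemma trace_square_CHAR_2:
  fixes x :: "'a::field^4^4"
  assumes "CHAR('a) = 2" "trace x = 0"
  shows "trace (x ** x) = 0"
proof -
  have "(2::'a) = 0"
    using of_nat_CHAR[where 'a='a] assms(1) by simp
  moreover have "trace (x ** x) = trace x * trace x - 2 * char_coeff2 x"
    unfolding trace_def matrix_matrix_mult_def char_coeff2_def minor2_def sum_4 vec_lambda_beta
    by algebra
  ultimately show ?thesis
    using assms(2) by simp
qed

text \<open>
  Trace zero removes from the linearised Cayley--Hamilton identity the terms that need not lie in
  the span: those with \<open>x\<^sup>3\<close> and with \<open>x\<^sup>2 y + x y x + y x\<^sup>2\<close>.
\<close>

lemma lie_bracket_cube_in_span:
  fixes x y :: "'a::field^4^4"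
  assumes "CHAR('a) = 2" "trace x = 0" "trace y = 0"
  shows "lie_bracket x (lie_bracket x (lie_bracket x y))
    \<in> mat_vs.span {mat 1, x, x ** x, y, lie_bracket x y}"
proof -
  have "x ** y + y ** x = lie_bracket x y"
    by (simp add: lie_bracket_def matrix_minus_CHAR_2[OF assms(1)])
  then show ?thesis
    unfolding lie_bracket_cube_CHAR_2[OF assms(1)] cayley_hamilton_linearised
    by (simp add: assms(2,3))
      (intro mat_vs.span_add mat_vs.span_diff mat_vs.span_neg mat_vs.span_scale mat_vs.span_base; simp)
qed

text \<open>
  The span may be larger than the Lie algebra generated by \<open>x\<close> and \<open>y\<close>: it contains the squares of
  the generators as well, which lets \<open>[x\<^sup>2, y]\<close> stand for \<open>[x, [x, y]]\<close> and
  \<open>[x\<^sup>2, y\<^sup>2]\<close> for \<open>[x, [y, [x, y]]]\<close>. The identity matrix enters through the last term of the linearised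
  Cayley--Hamilton identity.
\<close>

definition two_generator_spanning_set :: "'a::field^4^4 \<Rightarrow> 'a^4^4 \<Rightarrow> ('a^4^4) set"
  where "two_generator_spanning_set x y =
    {mat 1, x, y, x ** x, y ** y, lie_bracket x y, lie_bracket (x ** x) y,
     lie_bracket x (y ** y), lie_bracket (x ** x) (y ** y)}"

lemma two_generator_spanning_set_commute:
  fixes x y :: "'a::field^4^4"
  assumes "CHAR('a) = 2"
  shows "two_generator_spanning_set x y = two_generator_spanning_set y x"
  unfolding two_generator_spanning_set_def
  by (auto simp: lie_bracket_commute_CHAR_2[OF assms])

lemma generator_and_square_in_normalizer:
  fixes x y :: "'a::field^4^4"
  assumes char: "CHAR('a) = 2" and "trace x = 0" "trace y = 0"
  defines "V \<equiv> mat_vs.span (two_generator_spanning_set x y)"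
  shows "x \<in> lie_normalizer V" "x ** x \<in> lie_normalizer V"
proof -
  note square = lie_bracket_square_CHAR_2[OF char]
  \<comment> \<open>For the two values of \<open>z\<close> these are the brackets of \<open>x\<close> with \<open>[x\<^sup>2, y]\<close> and \<open>[x\<^sup>2, y\<^sup>2]\<close>.\<close>
  have *: "lie_bracket x (lie_bracket x (lie_bracket x z)) \<in> V"
    if "z \<in> {y, y ** y}" for z
  proof -
    have "trace z = 0"
      using that assms(3) trace_square_CHAR_2[OF char] by auto
    moreover have "{mat 1, x, x ** x, z, lie_bracket x z} \<subseteq> two_generator_spanning_set x y"
      using that by (auto simp: two_generator_spanning_set_def)
    ultimately show ?thesis
      using lie_bracket_cube_in_span[OF char assms(2), of z] mat_vs.span_mono
      unfolding V_def by blast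
  qed
  have "lie_bracket x b \<in> V" if "b \<in> two_generator_spanning_set x y" for b
  proof -
    have "lie_bracket x x = 0" "lie_bracket x (x ** x) = 0" by simp_all
    moreover have "lie_bracket x (lie_bracket x y) \<in> V" "lie_bracket x (lie_bracket x (y ** y)) \<in> V"
      "lie_bracket x y \<in> V" "lie_bracket x (y ** y) \<in> V" "0 \<in> V"
      unfolding square[symmetric] V_def
      by (auto intro!: mat_vs.span_base mat_vs.span_zero simp: two_generator_spanning_set_def)
    ultimately show ?thesis
      using that *[of y] *[of "y ** y"] by (auto simp: two_generator_spanning_set_def square)
  qed
  then have ad_x: "lie_bracket x v \<in> V" if "v \<in> V" for v
    using lie_bracket_in_span that unfolding V_def by blast
  then show "x \<in> lie_normalizer V"
    by (simp add: lie_normalizer_def)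
  from ad_x show "x ** x \<in> lie_normalizer V"
    by (simp add: lie_normalizer_def square)
qed

lemma lie_subalgebra_span_two_generator_spanning_set:
  fixes x y :: "'a::field^4^4"
  assumes char: "CHAR('a) = 2" and "trace x = 0" "trace y = 0"
  shows "lie_subalgebra (mat_vs.span (two_generator_spanning_set x y))" (is "lie_subalgebra ?V")
proof (rule lie_subalgebra_if_subset_lie_normalizer)
  show "mat_vs.subspace ?V"
    by (rule mat_vs.subspace_span)
  then have N: "lie_subalgebra (lie_normalizer ?V)"
    by (rule lie_subalgebra_lie_normalizer)
  have "x \<in> lie_normalizer ?V" "x ** x \<in> lie_normalizer ?V"
    "y \<in> lie_normalizer ?V" "y ** y \<in> lie_normalizer ?V"
    using generator_and_square_in_normalizer[OF assms]
      generator_and_square_in_normalizer[OF assms(1,3,2)]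
    by (simp_all add: two_generator_spanning_set_commute[OF char, of y x])
  moreover have "mat 1 \<in> lie_normalizer ?V"
    by (simp add: lie_normalizer_def mat_vs.span_zero)
  ultimately have "two_generator_spanning_set x y \<subseteq> lie_normalizer ?V"
    using N by (auto simp: two_generator_spanning_set_def lie_subalgebra_def)
  then show "?V \<subseteq> lie_normalizer ?V"
    using N by (intro mat_vs.span_minimal) (simp_all add: lie_subalgebra_def)
qed

lemma dim_lie_generated_pair_le:
  fixes x y :: "'a::field^4^4"
  assumes "CHAR('a) = 2" "x \<in> sl" "y \<in> sl"
  shows "mat_vs.dim (lie_generated {x, y}) \<le> 9"
proof -
  let ?B = "two_generator_spanning_set x y"
  let ?xs = "[mat 1, x, y, x ** x, y ** y, lie_bracket x y, lie_bracket (x ** x) y,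
    lie_bracket x (y ** y), lie_bracket (x ** x) (y ** y)]"
  have "lie_generated {x, y} \<subseteq> mat_vs.span ?B"
    using assms lie_subalgebra_span_two_generator_spanning_set[of x y]
    by (intro lie_generated_least)
      (auto simp: sl_def two_generator_spanning_set_def intro: mat_vs.span_base)
  moreover have "finite ?B"
    by (simp add: two_generator_spanning_set_def)
  ultimately have "mat_vs.dim (lie_generated {x, y}) \<le> card ?B"
    by (intro mat_vs.dim_le_card)
  also have "\<dots> \<le> length ?xs"
    using card_length[of ?xs] by (simp only: two_generator_spanning_set_def list.set)
  also have "length ?xs = 9"
    by simp
  finally show ?thesis .
qed

section \<open>Matrix units\<close>

lemma mat_unit_off_diagonal_in_sl: "i \<noteq> j \<Longrightarrow> mat_unit (i, j) \<in> sl"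
  by (auto simp: sl_def trace_def mat_unit_def intro: sum.neutral)

lemma lie_bracket_mat_unit:
  fixes i j k l :: "'n::finite"
  shows "lie_bracket (mat_unit (i, j)) (mat_unit (k, l)) =
    (if j = k then mat_unit (i, l) else 0) - (if l = i then mat_unit (k, j) else (0 :: 'a::field^'n^'n))"
proof -
  have mult: "mat_unit (i, j) ** mat_unit (k, l) =
    (if j = k then mat_unit (i, l) else (0 :: 'a^'n^'n))" for i j k l :: 'n
  proof -
    have "(\<Sum>m\<in>UNIV. (if a = i \<and> m = j then 1 else 0) * (if m = k \<and> b = l then 1 else (0::'a)))
      = (\<Sum>m\<in>UNIV. if m = j then if a = i \<and> j = k \<and> b = l then 1 else 0 else 0)" for a b
      by (rule sum.cong) auto
    then show ?thesis
      by (auto simp: mat_unit_def matrix_matrix_mult_def vec_eq_iff)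
  qed
  show ?thesis
    by (simp add: lie_bracket_def mult)
qed

text \<open>
  The brackets \<open>[E\<^sub>i\<^sub>k, E\<^sub>k\<^sub>i] = E\<^sub>i\<^sub>i - E\<^sub>k\<^sub>k\<close> for one fixed index \<open>k\<close> supply the diagonal traceless matrices.
\<close>

lemma sl_subset_if_off_diagonal_units:
  fixes L :: "('a::field^'n^'n) set"
  assumes "lie_subalgebra L" and off_diagonal: "\<And>i j. i \<noteq> j \<Longrightarrow> mat_unit (i, j) \<in> L"
  shows "sl \<subseteq> L"
proof
  fix A :: "'a^'n^'n"
  assume "A \<in> sl"
  have L: "mat_vs.subspace L" and bracket: "\<And>u v. u \<in> L \<Longrightarrow> v \<in> L \<Longrightarrow> lie_bracket u v \<in> L"
    using assms(1) by (auto simp: lie_subalgebra_def)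
  \<comment> \<open>Subtracting \<open>E\<^sub>k\<^sub>k\<close> from each diagonal unit changes the expansion of \<open>A\<close> by
    \<open>trace A\<close> times \<open>E\<^sub>k\<^sub>k\<close>, which is zero; any index serves as \<open>k\<close>.\<close>
  define k :: 'n where "k = undefined"
  define d :: "'n \<times> 'n \<Rightarrow> 'a^'n^'n"
    where "d p = (if fst p = snd p then mat_unit (k, k) else 0)" for p
  have "mat_unit p - d p \<in> L" for p
  proof (cases p)
    case (Pair i j)
    consider "i \<noteq> j" | "i = j" "i = k" | "i = j" "i \<noteq> k" by blast
    then show ?thesis
    proof cases
      case 3
      then have "mat_unit p - d p = lie_bracket (mat_unit (i, k)) (mat_unit (k, i))"
        by (simp add: Pair d_def lie_bracket_mat_unit)
      then show ?thesis
        using 3 off_diagonal by (simp add: bracket)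
    qed (auto simp: Pair d_def off_diagonal mat_vs.subspace_0[OF L])
  qed
  then have "(\<Sum>p\<in>UNIV. mat_scale (A $ fst p $ snd p) (mat_unit p - d p)) \<in> L"
    by (intro mat_vs.subspace_sum[OF L] mat_vs.subspace_scale[OF L])
  moreover have "(\<Sum>p\<in>UNIV. mat_scale (A $ fst p $ snd p) (d p)) = 0"
  proof -
    have "(\<Sum>p\<in>UNIV. mat_scale (A $ fst p $ snd p) (d p))
      = (\<Sum>i\<in>UNIV. \<Sum>j\<in>UNIV. mat_scale (A $ i $ j) (d (i, j)))"
      by (simp add: sum.cartesian_product case_prod_beta)
    also have "\<dots> = (\<Sum>i\<in>UNIV. \<Sum>j\<in>UNIV. if j = i then mat_scale (A $ i $ i) (mat_unit (k, k)) else 0)"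
      by (intro sum.cong) (auto simp: d_def)
    also have "\<dots> = mat_scale (trace A) (mat_unit (k, k))"
      by (simp add: trace_def mat_vs.scale_sum_left)
    finally show ?thesis
      using \<open>A \<in> sl\<close> by (simp add: sl_def)
  qed
  moreover have "A = (\<Sum>p\<in>UNIV. mat_scale (A $ fst p $ snd p) (mat_unit p))"
    by (simp add: mat_unit_expansion)
  ultimately show "A \<in> L"
    by (simp add: mat_vs.scale_right_diff_distrib sum_subtractf)
qed

lemma dim_sl_4_ge: "12 \<le> mat_vs.dim (sl :: ('a::field^4^4) set)"
proof -
  define P :: "(4 \<times> 4) set" where "P = UNIV - range (\<lambda>i. (i, i))"
  have "card (range (\<lambda>i::4. (i, i))) = 4"
    by (subst card_image) (auto intro: injI)
  then have "card P = 12"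
    by (simp add: P_def card_Diff_subset)
  then have "card (mat_unit ` P :: ('a^4^4) set) = 12"
    by (simp add: card_image inj_on_subset[OF inj_mat_unit])
  moreover have "mat_vs.independent (mat_unit ` P :: ('a^4^4) set)"
    by (rule mat_vs.independent_mono[OF mat_vs.independent_Basis]) auto
  moreover have "mat_unit ` P \<subseteq> (sl :: ('a^4^4) set)"
    by (auto simp: P_def intro!: mat_unit_off_diagonal_in_sl)
  ultimately show ?thesis
    using mat_vs.independent_card_le_dim[of "mat_unit ` P" "sl :: ('a^4^4) set"] by simp
qed

text \<open>
  The units \<open>E\<^sub>1\<^sub>2\<close>, \<open>E\<^sub>2\<^sub>3\<close>, \<open>E\<^sub>3\<^sub>4\<close>, \<open>E\<^sub>4\<^sub>1\<close> along a directed cycle generate all off-diagonal units. The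
  last two can be merged into one generator \<open>s = E\<^sub>3\<^sub>4 + E\<^sub>4\<^sub>1\<close>: brackets of \<open>s\<close> with \<open>E\<^sub>1\<^sub>2\<close> and \<open>E\<^sub>2\<^sub>3\<close> see
  only one summand each and yield \<open>E\<^sub>4\<^sub>2\<close> and \<open>E\<^sub>2\<^sub>4\<close>, whence \<open>E\<^sub>3\<^sub>2 = [s, E\<^sub>4\<^sub>2]\<close> and
  \<open>E\<^sub>3\<^sub>4 = [E\<^sub>3\<^sub>2, E\<^sub>2\<^sub>4]\<close>. All coefficients are \<open>0\<close> or \<open>1\<close>, so the argument works over every field.
\<close>

lemma sl_4_lie_3_generated: "lie_k_generated 3 (sl :: ('a::field^4^4) set)"
proof -
  define E :: "4 \<Rightarrow> 4 \<Rightarrow> 'a^4^4" where "E i j = mat_unit (i, j)" for i j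
  define L where "L = lie_generated {E 1 2, E 2 3, E 3 4 + E 4 1}"
  have L: "lie_subalgebra L"
    unfolding L_def by (rule lie_subalgebra_lie_generated)
  have bracket: "lie_bracket u v \<in> L" if "u \<in> L" "v \<in> L" for u v
    using L that by (simp add: lie_subalgebra_def)
  have diff: "u - v \<in> L" if "u \<in> L" "v \<in> L" for u v
    using L that by (simp add: lie_subalgebra_def mat_vs.subspace_diff)
  have product: "E i l \<in> L" if "E i j \<in> L" "E j l \<in> L" "i \<noteq> l" for i j l
    using bracket[OF that(1,2)] that(3) by (simp add: E_def lie_bracket_mat_unit)
  have distinct: "(1::4) \<noteq> 2" "(1::4) \<noteq> 3" "(1::4) \<noteq> 4" "(2::4) \<noteq> 3" "(2::4) \<noteq> 4" "(3::4) \<noteq> 4"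
    by simp_all
  note distinct = distinct distinct[symmetric]
  have gens: "E 1 2 \<in> L" "E 2 3 \<in> L" and s: "E 3 4 + E 4 1 \<in> L"
    using lie_generated_superset[of "{E 1 2, E 2 3, E 3 4 + E 4 1}"] by (simp_all add: L_def)
  note unit_simps = E_def lie_bracket_mat_unit lie_bracket_add_left lie_bracket_add_right distinct
  have "lie_bracket (E 3 4 + E 4 1) (E 1 2) = E 4 2"
    by (simp add: unit_simps)
  then have "E 4 2 \<in> L"
    using bracket[OF s gens(1)] by simp
  have "lie_bracket (E 2 3) (E 3 4 + E 4 1) = E 2 4"
    by (simp add: unit_simps)
  then have "E 2 4 \<in> L"
    using bracket[OF gens(2) s] by simp
  have "lie_bracket (E 3 4 + E 4 1) (E 4 2) = E 3 2"
    by (simp add: unit_simps)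
  then have "E 3 2 \<in> L"
    using bracket[OF s \<open>E 4 2 \<in> L\<close>] by simp
  have "E 3 4 \<in> L"
    using product[OF \<open>E 3 2 \<in> L\<close> \<open>E 2 4 \<in> L\<close>] by (simp add: distinct)
  then have "E 4 1 \<in> L"
    using diff[OF s, of "E 3 4"] by simp
  have "E 1 3 \<in> L" "E 1 4 \<in> L" "E 2 1 \<in> L" "E 3 1 \<in> L" "E 4 3 \<in> L"
    using product[OF \<open>E 1 2 \<in> L\<close> \<open>E 2 3 \<in> L\<close>] product[OF \<open>E 1 2 \<in> L\<close> \<open>E 2 4 \<in> L\<close>]
      product[OF \<open>E 2 4 \<in> L\<close> \<open>E 4 1 \<in> L\<close>] product[OF \<open>E 3 4 \<in> L\<close> \<open>E 4 1 \<in> L\<close>]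
      product[OF \<open>E 4 2 \<in> L\<close> \<open>E 2 3 \<in> L\<close>]
    by (simp_all add: distinct)
  with gens \<open>E 2 4 \<in> L\<close> \<open>E 3 2 \<in> L\<close> \<open>E 3 4 \<in> L\<close> \<open>E 4 1 \<in> L\<close> \<open>E 4 2 \<in> L\<close>
  have "\<forall>i j. i \<noteq> j \<longrightarrow> E i j \<in> L"
    by (simp add: forall_4)
  then have "sl \<subseteq> L"
    using L by (intro sl_subset_if_off_diagonal_units) (simp_all add: E_def)
  moreover have gens_sl: "{E 1 2, E 2 3, E 3 4 + E 4 1} \<subseteq> sl"
    using lie_subalgebra_sl[where 'a='a and 'n=4]
    by (auto simp: E_def lie_subalgebra_def intro!: mat_vs.subspace_add mat_unit_off_diagonal_in_sl)
  then have "L \<subseteq> sl"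
    unfolding L_def by (intro lie_generated_least lie_subalgebra_sl)
  ultimately have "lie_generated (set [E 1 2, E 2 3, E 3 4 + E 4 1]) = sl"
    by (simp add: L_def)
  then show ?thesis
    unfolding lie_k_generated_def using gens_sl
    by (intro exI[of _ "[E 1 2, E 2 3, E 3 4 + E 4 1]"]) simp
qed

section \<open>Two elements do not generate, three do\<close>

theorem theorem6p4:
  assumes "CHAR('a::field) = 2"
  shows "(\<forall>x \<in> (sl :: ('a^4^4) set). \<forall>y \<in> (sl :: ('a^4^4) set).
            mat_vs.dim (lie_generated {x, y}) \<le> 9)
    \<and> \<not> lie_k_generated 2 (sl :: ('a^4^4) set)
    \<and> lie_k_generated 3 (sl :: ('a^4^4) set)"
proof (intro conjI ballI)
  show dim_le: "mat_vs.dim (lie_generated {x, y}) \<le> 9" if "x \<in> sl" "y \<in> sl" for x y :: "'a^4^4"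
    using assms that by (rule dim_lie_generated_pair_le)
  show "\<not> lie_k_generated 2 (sl :: ('a^4^4) set)"
  proof
    assume "lie_k_generated 2 (sl :: ('a^4^4) set)"
    then obtain x y :: "'a^4^4" where "x \<in> sl" "y \<in> sl" "lie_generated {x, y} = sl"
      by (auto simp: lie_k_generated_def numeral_2_eq_2 length_Suc_conv)
    then show False
      using dim_le[of x y] dim_sl_4_ge[where 'a='a] by simp
  qed
  show "lie_k_generated 3 (sl :: ('a^4^4) set)"
    by (rule sl_4_lie_3_generated)
qed

end
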